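(* Let $a,b$ be coprime positive integers with $(a,b)\neq(1,1)$ and let $\psi\in\mathscr{T}(a,b)$. Suppose that $a$ and $b$ are $\psi$-independent. Writing $c=a+b$, we have $$\frac{c}{\log c}\le \mathrm{rad}(abc)\cdot\frac{\|\psi\|}{\log 2}.$$
   Context: For a prime $p$, $v_p$ is the $p$-adic valuation. For a non-zero integer $n$, $\mathrm{supp}(n)$ is the set of primes dividing $n$; for a positive integer $n$, $\mathrm{rad}(n)$ is the product of the distinct primes dividing $n$. Let $\Omega$ be the free $\mathbb{Z}$-module on symbols $\xi_p$, one for each prime $p$. Define $\mathrm{d}:\mathbb{Z}\to\Omega$ by $\mathrm{d}0=0$ and $\mathrm{d}n=\sum_{p\mid n}\frac{n\,v_p(n)}{p}\,\xi_p$ for $n\ne 0$ (the coefficients are integers). For a $\mathbb{Z}$-linear map $\psi:\Omega\to\mathbb{Z}$ put $\|\psi\|=\sup_p|\psi(\xi_p)|$. Let $\mathscr{T}$ be the $\mathbb{Z}$-module of all $\mathbb{Z}$-linear $\psi:\Omega\to\mathbb{Z}$ with $\|\psi\|<\infty$. For $\psi\in\mathscr{T}$ let $\mathrm{d}^\psi=\psi\circ\mathrm{d}:\mathbb{Z}\to\mathbb{Z}$ and $\mathrm{supp}(\psi)=\{p:\psi(\xi_p)\neq0\}$. For positive integers $a,b$, $$\mathscr{T}(a,b)=\{\psi\in\mathscr{T}:\ \mathrm{supp}(\psi)\subseteq\mathrm{supp}(ab(a+b))\ \text{and}\ \mathrm{d}^\psi(a+b)=\mathrm{d}^\psi a+\mathrm{d}^\psi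 b\}.$$ Integers $a,b$ are $\psi$-independent if $W^\psi(a,b):=a\,\mathrm{d}^\psi b-b\,\mathrm{d}^\psi a\neq 0$. *)

theory Defs
  imports Complex_Main "HOL-Computational_Algebra.Primes" "HOL-Library.Poly_Mapping"
begin

text \<open>
  Primes are integers here; \<^term>\<open>prime (p::int)\<close> entails \<^term>\<open>p > 0\<close>. They form a type,
  so that the free \<open>\<int>\<close>-module \<open>\<Omega>\<close> on symbols indexed by the primes is the type of finitely
  supported functions from that type to \<^typ>\<open>int\<close>, with scalar multiplication
  \<^const>\<open>frag_cmul\<close>.
\<close>

typedef prime_int = "{p::int. prime p}"
  morphisms of_prime to_prime
  by (intro exI[of _ 2]) simp

type_synonym \<Omega> = "prime_int \<Rightarrow>\<^sub>0 int"

abbreviation \<xi> :: "prime_int \<Rightarrow> \<Omega>" where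
  "\<xi> p \<equiv> frag_of p"

text \<open>Only meant for non-zero \<open>n\<close>.\<close>

definition supp_int :: "int \<Rightarrow> prime_int set" where
  "supp_int n = {p. of_prime p dvd n}"

definition rad :: "int \<Rightarrow> int" where
  "rad n = \<Prod>(prime_factors n)"

text \<open>The division by \<open>p\<close> in the coefficient is exact; see \<open>lookup_univ_deriv\<close> below.\<close>

definition univ_deriv :: "int \<Rightarrow> \<Omega>" where
  "univ_deriv n = (if n = 0 then 0 else
     (\<Sum>p\<in>supp_int n.
        frag_cmul (n * int (multiplicity (of_prime p) n) div of_prime p) (\<xi> p)))"

text \<open>
  The supremum is that of the conditionally complete type \<^typ>\<open>real\<close>, hence meaningful only for
  bounded \<open>\<psi>\<close>. Boundedness is imposed separately in \<open>bounded_functionals\<close>, which is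
  \<open>\<T>\<close>.
\<close>

definition functional_norm :: "(\<Omega> \<Rightarrow> int) \<Rightarrow> real" where
  "functional_norm \<psi> = (SUP p. real_of_int \<bar>\<psi> (\<xi> p)\<bar>)"

definition bounded_functionals :: "(\<Omega> \<Rightarrow> int) set" where
  "bounded_functionals =
     {\<psi>. module_hom frag_cmul (*) \<psi> \<and> bdd_above (range (\<lambda>p. real_of_int \<bar>\<psi> (\<xi> p)\<bar>))}"

definition supp_functional :: "(\<Omega> \<Rightarrow> int) \<Rightarrow> prime_int set" where
  "supp_functional \<psi> = {p. \<psi> (\<xi> p) \<noteq> 0}"

definition deriv_along :: "(\<Omega> \<Rightarrow> int) \<Rightarrow> int \<Rightarrow> int" where
  "deriv_along \<psi> = \<psi> \<circ> univ_deriv"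

text \<open>\<open>\<T>(a, b)\<close>, for positive \<open>a\<close> and \<open>b\<close>.\<close>

definition additive_functionals :: "int \<Rightarrow> int \<Rightarrow> (\<Omega> \<Rightarrow> int) set" where
  "additive_functionals a b =
     {\<psi> \<in> bounded_functionals.
        supp_functional \<psi> \<subseteq> supp_int (a * b * (a + b)) \<and>
        deriv_along \<psi> (a + b) = deriv_along \<psi> a + deriv_along \<psi> b}"

definition wronskian :: "(\<Omega> \<Rightarrow> int) \<Rightarrow> int \<Rightarrow> int \<Rightarrow> int" where
  "wronskian \<psi> a b = a * deriv_along \<psi> b - b * deriv_along \<psi> a"

definition independent_along :: "(\<Omega> \<Rightarrow> int) \<Rightarrow> int \<Rightarrow> int \<Rightarrow> bool" where
  "independent_along \<psi> a b \<longleftrightarrow> wronskian \<psi> a b \<noteq> 0"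

lemma prime_of_prime [simp]: "prime (of_prime p)"
  using of_prime[of p] by simp

lemma finite_supp_int: "n \<noteq> 0 \<Longrightarrow> finite (supp_int n)"
proof -
  assume "n \<noteq> 0"
  then have "of_prime ` supp_int n \<subseteq> prime_factors n"
    by (auto simp: supp_int_def in_prime_factors_iff)
  then have "finite (of_prime ` supp_int n)"
    by (rule finite_subset) simp
  then show ?thesis
    by (rule finite_imageD) (simp add: inj_on_def of_prime_inject)
qed

lemma module_frag_cmul: "module (frag_cmul :: int \<Rightarrow> ('a \<Rightarrow>\<^sub>0 int) \<Rightarrow> _)"
  by unfold_locales (simp_all add: frag_cmul_distrib frag_cmul_distrib2)

lemma lookup_univ_deriv:
  assumes "n \<noteq> 0"
  shows "of_prime p * Poly_Mapping.lookup (univ_deriv n) p = n * int (multiplicity (of_prime p) n)"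
proof -
  have "Poly_Mapping.lookup (univ_deriv n) p =
      (if p \<in> supp_int n then n * int (multiplicity (of_prime p) n) div of_prime p else 0)"
    using assms finite_supp_int[OF assms]
    by (simp add: univ_deriv_def lookup_sum when_def if_distrib[of "\<lambda>x. _ * x"]
        cong: if_cong)
  then show ?thesis
    by (auto simp: supp_int_def not_dvd_imp_multiplicity_0)
qed

end

theory Submission
  imports Defs
begin

text \<open>
  Since \<open>d\<^sup>\<psi> c = d\<^sup>\<psi> a + d\<^sup>\<psi> b\<close>, the Wronskian \<open>W = W\<^sup>\<psi>(a, b)\<close> equals
  \<open>a d\<^sup>\<psi> b - b d\<^sup>\<psi> a = a d\<^sup>\<psi> c - c d\<^sup>\<psi> a\<close>. As \<open>n\<close> divides \<open>rad n \<cdot> d\<^sup>\<psi> n\<close>, each of the pairwise coprime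
  numbers \<open>a, b, c\<close> divides \<open>rad (abc) W\<close>, so \<open>abc \<le> rad (abc) \<bar>W\<bar>\<close>. On the other hand
  \<open>d\<^sup>\<psi> n / n = \<Sum>\<^sub>p v\<^sub>p(n) \<psi>(\<xi>\<^sub>p) / p\<close>, and \<open>1 / p \<le> ln p / (2 ln 2)\<close> gives
  \<open>\<bar>d\<^sup>\<psi> n\<bar> \<le> n \<parallel>\<psi>\<parallel> ln n / (2 ln 2)\<close>; hence \<open>\<bar>W\<bar> \<le> ab \<parallel>\<psi>\<parallel> ln c / ln 2\<close>.
\<close>

lemma deriv_along_eq_sum:
  assumes "module_hom frag_cmul (*) \<psi>" "n \<noteq> 0"
  shows "deriv_along \<psi> n =
    (\<Sum>p\<in>supp_int n. (n * int (multiplicity (of_prime p) n) div of_prime p) * \<psi> (\<xi> p))"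
  using assms
  by (simp add: deriv_along_def univ_deriv_def module_hom.sum module_hom.scale)

text \<open>Needed to reindex the prime factorisation, a product over integers, by the prime type
  that indexes the basis of \<Omega>.\<close>

lemma bij_betw_of_prime_supp_int:
  assumes "n \<noteq> 0"
  shows "bij_betw of_prime (supp_int n) (prime_factors n)"
  using assms
  by (intro bij_betw_byWitness[where f' = to_prime])
    (auto simp: supp_int_def in_prime_factors_iff of_prime_inverse to_prime_inverse)

lemma rad_pos: "rad n > 0"
  unfolding rad_def by (intro prod_pos) (auto simp: in_prime_factors_iff prime_gt_0_int)

lemma rad_dvd_rad:
  assumes "m dvd n" "n \<noteq> 0"
  shows "rad m dvd rad n"
  unfolding rad_def using assms by (intro prod_dvd_prod_subset dvd_prime_factors) auto

text \<open>Each summand falls short of being a multiple of \<open>n\<close> only by one division by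
  a prime of \<open>n\<close>, and \<open>rad n\<close> supplies that prime.\<close>

lemma dvd_rad_mult_deriv_along:
  assumes "module_hom frag_cmul (*) \<psi>" "n \<noteq> 0"
  shows "n dvd rad n * deriv_along \<psi> n"
  unfolding deriv_along_eq_sum[OF assms] sum_distrib_left
proof (rule dvd_sum)
  fix p assume p: "p \<in> supp_int n"
  then have pn: "of_prime p dvd n"
    by (simp add: supp_int_def)
  have "of_prime p dvd rad n"
    unfolding rad_def using pn assms(2) by (intro dvd_prodI) (auto simp: in_prime_factors_iff)
  then obtain r where r: "rad n = of_prime p * r" by blast
  have "of_prime p * (n * int (multiplicity (of_prime p) n) div of_prime p)
      = n * int (multiplicity (of_prime p) n)"
    using pn by simp
  then have "rad n * (n * int (multiplicity (of_prime p) n) div of_prime p * \<psi> (\<xi> p))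
      = n * (int (multiplicity (of_prime p) n) * r * \<psi> (\<xi> p))"
    unfolding r by (metis mult.assoc mult.commute)
  then show "n dvd rad n * (n * int (multiplicity (of_prime p) n) div of_prime p * \<psi> (\<xi> p))"
    by (rule dvdI)
qed

lemma ln_eq_sum_supp_int:
  assumes "n > 0"
  shows "ln (real_of_int n) =
    (\<Sum>p\<in>supp_int n. real (multiplicity (of_prime p) n) * ln (real_of_int (of_prime p)))"
proof -
  have "n = (\<Prod>p\<in>prime_factors n. p ^ multiplicity p n)"
    using assms prod_prime_factors[of n] by simp
  also have "\<dots> = (\<Prod>p\<in>supp_int n. of_prime p ^ multiplicity (of_prime p) n)"
    using assms
    by (intro prod.reindex_bij_betw[OF bij_betw_of_prime_supp_int, symmetric]) simp
  finally have "real_of_int n =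
      (\<Prod>p\<in>supp_int n. real_of_int (of_prime p) ^ multiplicity (of_prime p) n)"
    by (metis (no_types, lifting) of_int_power of_int_prod prod.cong)
  moreover have "real_of_int (of_prime p) > 0" for p
    by (simp add: prime_gt_0_int)
  ultimately show ?thesis
    using finite_supp_int[of n] assms by (simp add: ln_prod ln_realpow)
qed

text \<open>Both factors of \<open>x * ln x\<close> increase, so its least value on this range is at
  the smallest prime 2, which is where the constant comes from.\<close>

lemma inverse_le_ln_over_2_ln_2:
  assumes "x \<ge> (2::real)"
  shows "1 / x \<le> ln x / (2 * ln 2)"
proof -
  have "2 * ln 2 \<le> x * ln x"
    using assms by (intro mult_mono) auto
  then show ?thesis
    using assms by (simp add: field_simps)
qed

text \<open>Trading 1/p for a multiple of ln p termwise lets the sum of v_p(n) ln p collapse to ln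
  n.\<close>

lemma abs_deriv_along_le:
  assumes "module_hom frag_cmul (*) \<psi>" "n > 0"
    and N: "\<And>p. real_of_int \<bar>\<psi> (\<xi> p)\<bar> \<le> N"
  shows "\<bar>real_of_int (deriv_along \<psi> n)\<bar> \<le> real_of_int n * N * ln (real_of_int n) / (2 * ln 2)"
proof -
  define q where "q p = real_of_int (of_prime p)" for p
  define v where "v p = real (multiplicity (of_prime p) n)" for p
  define t where "t p = real_of_int (\<psi> (\<xi> p))" for p
  have q: "q p \<ge> 2" for p
    using prime_ge_2_int[of "of_prime p"] by (simp add: q_def)
  \<comment> \<open>On \<open>supp_int n\<close> the prime divides \<open>n\<close>, so the integer
    \<open>div\<close> is exact and becomes real division.\<close>
  have "real_of_int (deriv_along \<psi> n) = (\<Sum>p\<in>supp_int n. real_of_int n * v p / q p * t p)"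
    using assms(2)
    by (simp add: deriv_along_eq_sum[OF assms(1)] supp_int_def real_of_int_div q_def v_def t_def)
  also have "\<bar>\<dots>\<bar> \<le> (\<Sum>p\<in>supp_int n. \<bar>real_of_int n * v p / q p * t p\<bar>)"
    by (rule sum_abs)
  also have "\<dots> \<le> (\<Sum>p\<in>supp_int n. real_of_int n * N * (v p * ln (q p)) / (2 * ln 2))"
  proof (rule sum_mono)
    fix p
    have "\<bar>real_of_int n * v p / q p * t p\<bar> = real_of_int n * v p * (1 / q p * \<bar>t p\<bar>)"
      using assms(2) q[of p] by (simp add: abs_mult v_def)
    also have "\<dots> \<le> real_of_int n * v p * (ln (q p) / (2 * ln 2) * N)"
      using assms(2) q[of p] N[of p]
      by (intro mult_left_mono mult_mono inverse_le_ln_over_2_ln_2) (auto simp: t_def v_def)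
    finally show "\<bar>real_of_int n * v p / q p * t p\<bar>
        \<le> real_of_int n * N * (v p * ln (q p)) / (2 * ln 2)"
      by (simp add: mult_ac)
  qed
  also have "\<dots> = real_of_int n * N * ln (real_of_int n) / (2 * ln 2)"
    unfolding ln_eq_sum_supp_int[OF assms(2)] q_def v_def
    by (simp add: sum_distrib_left sum_divide_distrib)
  finally show ?thesis .
qed

theorem theorem3p3:
  fixes a b c :: int and \<psi> :: "\<Omega> \<Rightarrow> int"
  assumes "a > 0" and "b > 0" and "coprime a b" and "(a, b) \<noteq> (1, 1)"
    and "\<psi> \<in> additive_functionals a b"
    and "independent_along \<psi> a b"
    and "c = a + b"
  shows "real_of_int c / ln (real_of_int c)
      \<le> real_of_int (rad (a * b * c)) * (functional_norm \<psi> / ln 2)"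
proof -
  have hom: "module_hom frag_cmul (*) \<psi>"
    and bdd: "bdd_above (range (\<lambda>p. real_of_int \<bar>\<psi> (\<xi> p)\<bar>))"
    and add: "deriv_along \<psi> c = deriv_along \<psi> a + deriv_along \<psi> b"
    using assms(5,7) by (auto simp: additive_functionals_def bounded_functionals_def)
  define R where "R = rad (a * b * c)"
  define W where "W = wronskian \<psi> a b"
  define N where "N = functional_norm \<psi>"
  have N: "real_of_int \<bar>\<psi> (\<xi> p)\<bar> \<le> N" for p
    unfolding N_def functional_norm_def by (rule cSUP_upper[OF UNIV_I bdd])
  then have "N \<ge> 0"
    by (meson abs_ge_zero of_int_0_le_iff order_trans)
  have pos: "a > 0" "b > 0" "c > 0" "c \<ge> 2"
    using assms(1,2,7) by auto
  have "R > 0"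
    unfolding R_def by (rule rad_pos)
  \<comment> \<open>The radical of each divisor of abc divides \<open>R\<close>, so one multiplier
    serves a, b and c.\<close>
  have dvd_R: "n dvd R * deriv_along \<psi> n" if "n dvd a * b * c" "n \<noteq> 0" for n
    using dvd_trans[OF dvd_rad_mult_deriv_along[OF hom that(2)]
        mult_dvd_mono[OF rad_dvd_rad[OF that(1)] dvd_refl]] pos
    by (simp add: R_def)
  have a: "a dvd R * deriv_along \<psi> a" and b: "b dvd R * deriv_along \<psi> b"
    and c: "c dvd R * deriv_along \<psi> c"
    using pos by (auto intro!: dvd_R)
  \<comment> \<open>This form of \<open>R * W\<close> shows divisibility by a and by b; the next
    one, which rests on additivity, shows divisibility by c.\<close>
  have "a * (R * deriv_along \<psi> b) - b * (R * deriv_along \<psi> a) = R * W"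
    by (simp add: W_def wronskian_def algebra_simps)
  moreover have "a * (R * deriv_along \<psi> c) - c * (R * deriv_along \<psi> a) = R * W"
    unfolding add by (simp add: assms(7) W_def wronskian_def algebra_simps)
  ultimately have "a dvd R * W" "b dvd R * W" "c dvd R * W"
    using a b c by (metis dvd_diff dvd_mult dvd_triv_left)+
  moreover have "coprime (a * b) c"
    unfolding assms(7) coprime_mult_left_iff using assms(3)
    by (metis coprime_iff_gcd_eq_1 gcd.commute gcd_add1 gcd_add2)
  ultimately have "a * b * c dvd R * W"
    using assms(3) by (simp add: divides_mult)
  \<comment> \<open>Independence enters here: only for a nonzero multiple does divisibility give a
    lower bound on the size.\<close>
  moreover have "W \<noteq> 0"
    using assms(6) by (simp add: W_def independent_along_def)
  ultimately have "a * b * c \<le> R * \<bar>W\<bar>"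
    using dvd_imp_le_int[of "R * W" "a * b * c"] \<open>R > 0\<close> pos by (simp add: abs_mult)
  then have lower: "real_of_int (a * b) * real_of_int c \<le> real_of_int R * real_of_int \<bar>W\<bar>"
    by (metis of_int_le_iff of_int_mult)

  have bound: "\<bar>real_of_int (deriv_along \<psi> n)\<bar>
      \<le> real_of_int n * (N * ln (real_of_int c) / (2 * ln 2))" if "n > 0" "n \<le> c" for n
  proof -
    have "\<bar>real_of_int (deriv_along \<psi> n)\<bar> \<le> real_of_int n * N * ln (real_of_int n) / (2 * ln 2)"
      by (rule abs_deriv_along_le[OF hom that(1) N])
    also have "\<dots> \<le> real_of_int n * N * ln (real_of_int c) / (2 * ln 2)"
      using that \<open>N \<ge> 0\<close> by (intro divide_right_mono mult_left_mono) auto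
    finally show ?thesis by simp
  qed
  have "real_of_int \<bar>W\<bar> \<le> real_of_int a * \<bar>real_of_int (deriv_along \<psi> b)\<bar>
      + real_of_int b * \<bar>real_of_int (deriv_along \<psi> a)\<bar>"
    using abs_triangle_ineq4[of "real_of_int a * real_of_int (deriv_along \<psi> b)"
        "real_of_int b * real_of_int (deriv_along \<psi> a)"] pos
    by (simp add: W_def wronskian_def abs_mult)
  \<comment> \<open>Replacing ln a and ln b by ln c makes the two terms equal, so their sum turns 2
    ln 2 into ln 2.\<close>
  also have "\<dots> \<le> real_of_int a * (real_of_int b * (N * ln (real_of_int c) / (2 * ln 2)))
      + real_of_int b * (real_of_int a * (N * ln (real_of_int c) / (2 * ln 2)))"
    using pos assms(7) by (intro add_mono mult_left_mono bound) auto
  also have "\<dots> = real_of_int (a * b) * (N * ln (real_of_int c) / ln 2)"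
    by (simp add: field_simps)
  finally have "real_of_int R * real_of_int \<bar>W\<bar>
      \<le> real_of_int R * (real_of_int (a * b) * (N * ln (real_of_int c) / ln 2))"
    using \<open>R > 0\<close> by (intro mult_left_mono) auto
  with lower have "real_of_int (a * b) * real_of_int c
      \<le> real_of_int (a * b) * (real_of_int R * (N * ln (real_of_int c) / ln 2))"
    by (simp only: mult.left_commute)
  \<comment> \<open>The factor ab, common to the lower and the upper bound, cancels and leaves c
    alone.\<close>
  moreover have "real_of_int (a * b) > 0"
    using pos by simp
  ultimately have "real_of_int c \<le> real_of_int R * (N * ln (real_of_int c) / ln 2)"
    by (rule mult_left_le_imp_le)
  \<comment> \<open>As c is at least 2, ln c is positive and may be divided out.\<close>
  then show ?thesis
    using pos by (simp add: R_def N_def pos_divide_le_eq)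
qed

end
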